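(* Let $p_1,p_2\in\{-1,+1\}$ be arbitrary. The real numbers $\left(F_u^{xyz}\right)_{jk}$ (indexed by the simple objects $1,\alpha,\alpha^*,\rho,{}_\alpha\rho,{}_{\alpha^*}\rho$ of the fusion category $\mathcal{H}_3$) which are listed explicitly in the context, and which depend on the two sign parameters $p_1,p_2$, solve the pentagon equations for the $\mathcal{H}_3$ fusion rules: for all labels $x,y,z,w,u,a,b,c,d$ such that $N_{xy}^a=N_{az}^b=N_{bw}^u=1$ and $N_{zw}^c=N_{yc}^d=N_{xd}^u=1$, $$\left(F_u^{xyc}\right)_{da}\left(F_u^{azw}\right)_{cb}=\sum_e\left(F_d^{yzw}\right)_{ce}\left(F_u^{xew}\right)_{db}\left(F_b^{xyz}\right)_{ea},$$ where the sum runs over all labels $e$ with $N_{yz}^e=N_{xe}^b=N_{ew}^d=1$. Thus this is a real solution of the pentagon equations with two parameters $p_1,p_2\in\{-1,+1\}$.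
   Context: **Labels and fusion rules.** The fusion category $\mathcal{H}_3$ has six simple objects $1,\alpha,\alpha^*,\rho,{}_\alpha\rho,{}_{\alpha^*}\rho$. Write $\alpha^0=1$, $\alpha^1=\alpha$, $\alpha^2=\alpha^*$ and $\alpha^0\rho=\rho$, $\alpha^1\rho={}_\alpha\rho$, $\alpha^2\rho={}_{\alpha^*}\rho$, with exponents mod 3. The fusion rules are $\alpha^i\otimes\alpha^j=\alpha^{i+j}$, $\alpha^i\otimes\alpha^j\rho=\alpha^{i+j}\rho$, $\alpha^j\rho\otimes\alpha^i=\alpha^{j-i}\rho$, $\alpha^i\rho\otimes\alpha^j\rho=\alpha^{i-j}\oplus\rho\oplus{}_\alpha\rho\oplus{}_{\alpha^*}\rho$. $N_{xy}^z\in\{0,1\}$ is the multiplicity of $z$ in $x\otimes y$. **F-symbols.** For labels $x,y,z,u$ the matrix $F_u^{xyz}$ has entries $\left(F_u^{xyz}\right)_{jk}$, with row index $j$ ranging over labels with $N_{yz}^j=N_{xj}^u=1$ and column index $k$ ranging over labels with $N_{xy}^k=N_{kz}^u=1$. (It describes the change of basis of $\hom(u,x\otimes y\otimes z)$: left-bracketed tree with internal label $k$ equals $\sum_j (F_u^{xyz})_{jk}$ times the right-bracketed tree with internal label $j$.) The quadruple is admissible if $u$ occurs in $x\otimes y\otimes z$. If at least one of $x,y,z,u$ is in $\{1,\alpha,\alpha^*\}$ and the quadruple is admissible, the matrix is $1\times1$; otherwise it is $3\times 3$ or $4\times 4$. **Abbreviations used in the list.** Labels: $a=\alpha$, $b=\alpha^*$,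 $r=\rho$, $s={}_\alpha\rho$, $t={}_{\alpha^*}\rho$ (and $1$). Signs: $p=p_1$, $q=p_2$. Numbers: $A=\frac12(\sqrt{13}-3)$, $S=\sqrt{A}$, $B=\frac13(\sqrt{13}-2)$, $C=\frac16(\sqrt{13}+1)$, $P=D_+=\frac1{12}\left(5-\sqrt{13}+\sqrt{6(\sqrt{13}+1)}\right)$, $M=D_-=\frac1{12}\left(5-\sqrt{13}-\sqrt{6(\sqrt{13}+1)}\right)$. Products are written by juxtaposition, e.g. $Ppq=D_+p_1p_2$. A word $xyz$ listed under "$u=\cdot$" stands for $F_u^{xyz}$. (In the words and in "$u=\cdot$" the letters are labels; in the values they are numbers.) **(I) $1\times 1$ matrices.** Every admissible $1\times1$ matrix $F_u^{xyz}$ equals $1$, except the following. $u=1$: value $-1$: rst, sst, stt, tss, tts. Value $p$: str, tsr. Value $-p$: ast, bts, sta, trs, tsb. Value $q$: srt. Value $pq$: rts. Value $-pq$: rtt, ttr. $u=a$: value $-1$: rbr, sat, sbs, srt, sst, tst, ttr. Value $p$: rsr, rss, rts, tar, trr. Value $-p$: bst, btr, ras, rsb, stb, tsr. Value $q$: trt. Value $-pq$: rtr, stt, ttt. $u=b$: value $-1$: rar, rrr, sas, ssr, sss, sts, tbs, tst. Value $p$: rbt, rst, rtr, srs, str. Value $-p$: art, sbr, sra, srr. Value $q$: rtt. Value $pq$: tts. Value $-pq$: rrt, ttt. $u=r$: value $-1$: ara, arr, brb, bta, btr, rar, rra, sbs, sra, sta, tat, tbs, tbt, trb, tta. Value $p$: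 ras, sbr, srb, tar. Value $-p$: bbt, rbt, rsb, sbb. Value $q$: rta. Value $-q$: tra. Value $pq$: ast, tsb. Value $-pq$: rat, sbt, tas, tbr. $u=s$: value $-1$: atb, rat, rsa, rtb, sbt, stb, tar, tas, tbr. Value $p$: asa, asr, bsb, sbs, ssa, ssb, tsb. Value $-p$: aat, ass, ast, bas, bbr, bsr, bss, rar, sas, sba, sbr, sra, tbs. Value $q$: rra, tbt. Value $-q$: bst, ttb. Value $pq$: rbr, sat. Value $-pq$: ras, rsb. $u=t$: value $-1$: arb, bsa, bsr, rar, ras, rbs, sar, sbr, sbs, sbt, srb, tas, tbs, tsa. Value $p$: rrb, ssa, tar, tat, tbt. Value $-p$: abt, ata, atr, ats, att, btb, btr, bts, rbb, rbr, saa, sas, sat, sta, tab, trb, ttb. Value $-q$: btt, tta. Value $pq$: art. Value $-pq$: rtb. **(II) $3\times3$ matrices.** Rows and columns are both indexed by $r,s,t$ in this order; rows are separated by semicolons. $u=r$: rrs: [P, M, -C; M, C, -P; C, P, -M] rrt: [M, C, -Ppq; Cpq, Ppq, -M; P, M, -Cpq] rsr: [P, M, C; M, C, P; -Cp, -Pp, -Mp] rst: [-Cp, P, Mpq; P, -Mp, -Cq; M, -Cp, -Pq] rtr: [M, Cpq, P; Cp, Pq, Mp; P, Mpq, C] rts: [-Cp, Ppq, M; P, -Mq, -Cp; M, -Cq, -Pp] srr: [P, M, -Cp; M, C, -Pp; -C, -P, Mp] srs: [M, -Cp, P; -Cp, P, -Mp; -Pp, M, -Cp] sss: [C, P, M;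 P, M, C; M, C, P] sst: [P, M, Cpq; M, C, Ppq; C, P, Mpq] str: [-Cp, P, M; Pp, -M, -C; M, -Cp, -Pp] stt: [Mpq, Cpq, P; C, P, Mpq; P, M, Cpq] trr: [M, Cp, P; C, Pp, M; -Ppq, -Mq, -Cpq] trt: [P, -M, -Cq; -Mq, Cq, P; -Cq, Pq, M] tsr: [-Cp, P, M; P, -Mp, -Cp; -Mq, Cpq, Ppq] tss: [P, M, C; M, C, P; Cpq, Ppq, Mpq] tts: [Mpq, C, P; Cpq, P, M; P, Mpq, Cpq] ttt: [C, Ppq, M; Ppq, M, Cpq; M, Cpq, P] $u=s$: rrr: [P, M, -Cp; M, C, -Pp; -Cpq, -Ppq, Mq] rrt: [-Cq, P, -M; P, -Mq, Cq; M, -Cq, Pq] rsr: [M, -Cp, -P; -Cp, P, Mp; Ppq, -Mq, -Cpq] rss: [C, P, M; P, M, C; Mpq, Cpq, Ppq] rts: [P, Mpq, C; M, Cpq, P; Cpq, P, Mpq] rtt: [M, C, Ppq; Cpq, Ppq, M; P, M, Cpq] srs: [C, P, -Mp; P, M, -Cp; M, C, -Pp] srt: [Ppq, M, -Cp; M, Cpq, -Pq; Cpq, P, -Mp] ssr: [C, P, Mp; P, M, Cp; -Mp, -Cp, -P] sst: [Mpq, -Cp, -Pp; -Cq, P, M; -Pq, M, C] str: [P, M, Cp; Mp, Cp, P; C, P, Mp] sts: [M, -Cp, -Pp; -Cp, P, M; -Pp, M, C] trr: [-C, P, M; P, -M, -C; -M, C, P] trs: [Pp, M, Cp; M, Cp,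 P; C, Pp, M] tss: [Mp, -C, -P; -Cp, P, M; -Pp, M, C] tst: [Cq, -P, -M; -Pq, M, C; -Mq, C, P] ttr: [Mq, Cp, P; Cq, Pp, M; Ppq, M, Cp] ttt: [Pq, -Mpq, -Cpq; -Mp, C, P; -Cp, P, M] $u=t$: rrr: [M, Cp, P; -C, -Pp, -M; P, Mp, C] rrs: [Cp, -P, M; P, -Mp, Cp; M, -Cp, Pp] rss: [-P, -M, -C; M, C, P; C, P, M] rst: [-M, -C, -P; C, P, M; P, M, C] rtr: [P, -Mpq, Cp; M, -Cpq, Pp; Cp, -Pq, M] rtt: [-Cpq, -P, -Mpq; P, Mpq, C; M, Cpq, P] srr: [-C, P, M; -P, M, C; M, -C, -P] srt: [-Mp, -Cp, P; Cpq, Ppq, -Mq; P, M, -Cp] ssr: [Pp, M, -Cp; -M, -Cp, P; Cp, P, -Mp] sss: [-Mp, C, P; -Cp, P, M; -Pp, M, C] sts: [-Cp, P, M; -Pp, M, C; -Mp, C, P] stt: [-Pq, Mpq, Cpq; -Mp, C, P; -Cp, P, M] trs: [M, Cp, P; C, Pp, M; P, Mp, C] trt: [C, Pp, M; Ppq, Mq, Cpq; M, Cp, P] tsr: [-M, -Cp, P; -C, -Pp, M; Pp, M, -Cp] tst: [P, -Mp, -Cp; -Mp, C, P; -Cp, P, M] ttr: [-Cpq, -Pp, M; -Pq, -M, Cp; -Mpq, -Cp, P] tts: [Ppq, -Mp, -Cp; -Mq, C, P; -Cq, P, M] **(III) $4\times4$ matrices.** The notation "xyz (g|h)" means: rows are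 indexed by $g,r,s,t$ and columns by $h,r,s,t$ in this order, where $g$ is the invertible label in $y\otimes z$ and $h$ the invertible label in $x\otimes y$. $u=r$: rrr (1|1): [A, S, -pS, pS; S, -B, -Pp, Mp; -pS, -Pp, M, B; pS, Mp, B, P] rss (1|b): [A, -pS, S, S; S, -Mp, -B, P; -pS, -B, -Pp, -Mp; -pS, P, -Mp, Bp] rtt (1|a): [A, pS, -pqS, -pqS; -pqS, -Pq, M, -B; pS, M, Bq, -Pq; pS, -B, -Pq, -Mq] srt (a|a): [-A, pS, -S, qS; -pS, -B, -Pp, Mpq; pqS, -Pq, Mpq, Bp; S, -Mp, -B, -Pq] ssr (a|1): [A, S, -pS, -pS; -pS, -Mp, -B, P; S, -B, -Pp, -Mp; -pS, -Pp, M, -B] sts (a|b): [-A, -pS, -pS, -pS; pS, P, M, -B; pS, M, -B, P; pS, -B, P, M] trs (b|b): [-A, pS, -pS, -S; -pS, -B, -P, -Mp; S, -Pp, Mp, -B; pqS, -Mq, -Bq, Ppq] tst (b|a): [A, -pS, -pS, -qS; -pS, M, -B, Ppq; -pS, -B, P, Mpq; -qS, Ppq, Mpq, -B] ttr (b|1): [A, -pqS, pS, pS; pS, -Pq, M, -B; -pS, Mq, B, -P; -pqS, -B, -Pq, -Mq] $u=s$: rrs (b|1): [A, S, -pS, pS; -pS, -Mp, -B, -P; S, -B, -Pp, Mp; pqS, Ppq, -Mq, -Bq] rst (b|b): [Ap, qS, pS, pS; S, Ppq, M, -B; S, Mpq, -B, P; pqS, -B, Ppq, Mpq] rtr (b|a):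 [-A, -pS, pqS, pS; pS, -B, -Pq, -M; -pS, -P, Mq, -B; -pqS, -Mq, -B, Pq] srr (1|a): [A, -pS, S, -S; S, -Mp, -B, -P; -pS, -B, -Pp, Mp; pS, -P, Mp, Bp] sss (1|1): [A, S, -pS, -pS; S, P, -Mp, Bp; -pS, -Mp, -B, P; -pS, Bp, P, M] stt (1|b): [A, -pqS, pS, pS; -pqS, -B, -Pq, -Mq; pS, -Pq, M, -B; pS, -Mq, -B, P] trt (a|b): [A, pqS, pS, S; pS, Mq, -B, Pp; pqS, -B, Pq, Mpq; S, Ppq, Mp, -B] tsr (a|a): [Ap, -S, -S, -pS; -S, Pp, Mp, -B; -pS, M, -B, Pp; S, Bp, -Pp, -M] tts (a|1): [A, -pqS, pS, pS; -pS, -Bq, -P, -M; pS, -Pq, M, -B; pS, -Mq, -B, P] $u=t$: rrt (a|1): [A, S, -pS, pS; pS, Pp, -M, -B; pqS, Mpq, Bq, Pq; S, -B, -Pp, Mp] rsr (a|b): [-A, -pS, pS, -S; pS, -B, -P, Mp; S, Pp, -Mp, -B; -pS, -M, -B, -Pp] rts (a|a): [-Ap, pS, qS, pS; S, -M, Bpq, -P; -S, -B, Ppq, M; -S, P, Mpq, -B] srs (b|a): [-A, -S, -S, pS; -pS, -Pp, -Mp, -B; S, M, -B, -Pp; S, -B, P, -Mp] sst (b|1): [A, S, -pS, -pS; -pS, Bp, P, M; -pS, -Pp, M, -B; -pS, -Mp, -B, P] str (b|b): [-Ap, S, pS, -S; -S, Mp, -B, -Pp; S, Bp, -P, Mp;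 pS, -P, -Mp, -B] trr (1|b): [A, pS, -S, S; S, Pp, -M, -B; -pS, -M, -Bp, -Pp; pS, -B, -Pp, Mp] tss (1|a): [A, S, -pS, -pS; S, -B, -Pp, -Mp; -pS, -Pp, M, -B; -pS, -Mp, -B, P] ttt (1|1): [A, -pqS, pS, pS; -pqS, M, Bq, -Pq; pS, Bq, P, M; pS, -Pq, M, -B] *)

theory Defs
  imports Complex_Main "HOL-Library.Multiset"
begin

text \<open>
  The constructors \<open>L1, La, Lb, Lr, Ls, Lt\<close> are the simple objects
  \<open>1, \<alpha>, \<alpha>*, \<rho>, \<alpha>\<rho>, \<alpha>*\<rho>\<close> of the fusion category \<open>H\<^sub>3\<close>.
\<close>

datatype label = L1 | La | Lb | Lr | Ls | Lt

lemma UNIV_label: "UNIV = {L1, La, Lb, Lr, Ls, Lt}"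
  using label.exhaust by auto

instance label :: finite
  by standard (simp add: UNIV_label)

definition invertible :: "label \<Rightarrow> bool" where
  "invertible x \<longleftrightarrow> x \<in> {L1, La, Lb}"

text \<open>
  Every label is \<open>\<alpha>\<^sup>i\<close> (\<open>inv_lab i\<close>) or \<open>\<alpha>\<^sup>i\<rho>\<close> (\<open>rho_lab i\<close>), the exponent being read modulo 3;
  \<open>expo\<close> recovers \<open>i\<close>.
\<close>

definition inv_lab :: "int \<Rightarrow> label" where
  "inv_lab i = (if i mod 3 = 0 then L1 else if i mod 3 = 1 then La else Lb)"

definition rho_lab :: "int \<Rightarrow> label" where
  "rho_lab i = (if i mod 3 = 0 then Lr else if i mod 3 = 1 then Ls else Lt)"

fun expo :: "label \<Rightarrow> int" where
  "expo L1 = 0" | "expo La = 1" | "expo Lb = 2"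
| "expo Lr = 0" | "expo Ls = 1" | "expo Lt = 2"

definition fusion :: "label \<Rightarrow> label \<Rightarrow> label multiset" where
  "fusion x y =
    (if invertible x then
       if invertible y then {#inv_lab (expo x + expo y)#}
       else {#rho_lab (expo x + expo y)#}
     else
       if invertible y then {#rho_lab (expo x - expo y)#}
       else {#inv_lab (expo x - expo y), Lr, Ls, Lt#})"

definition N :: "label \<Rightarrow> label \<Rightarrow> label \<Rightarrow> nat" where
  "N x y z = count (fusion x y) z"

text \<open>The numbers occurring in the matrices; \<open>nP\<close> and \<open>nM\<close> are \<open>D\<^sub>+\<close> and \<open>D\<^sub>-\<close>.\<close>

definition nA :: real where "nA = (sqrt 13 - 3) / 2"
definition nS :: real where "nS = sqrt nA"
definition nB :: real where "nB = (sqrt 13 - 2) / 3"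
definition nC :: real where "nC = (sqrt 13 + 1) / 6"
definition nP :: real where "nP = (5 - sqrt 13 + sqrt (6 * (sqrt 13 + 1))) / 12"
definition nM :: real where "nM = (5 - sqrt 13 - sqrt (6 * (sqrt 13 + 1))) / 12"

text \<open>
  \<open>exceptions p q u\<close> lists, for each value different from 1 of a 1x1 matrix, the triples
  \<open>(x, y, z)\<close> for which \<open>F\<^sub>u\<^sup>x\<^sup>y\<^sup>z\<close> has that value.
\<close>

fun exceptions :: "real \<Rightarrow> real \<Rightarrow> label \<Rightarrow> (real \<times> (label \<times> label \<times> label) list) list" where
  "exceptions p q L1 =
     [(-1, [(Lr, Ls, Lt), (Ls, Ls, Lt), (Ls, Lt, Lt), (Lt, Ls, Ls), (Lt, Lt, Ls)]),
      (p, [(Ls, Lt, Lr), (Lt, Ls, Lr)]),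
      (-p, [(La, Ls, Lt), (Lb, Lt, Ls), (Ls, Lt, La), (Lt, Lr, Ls), (Lt, Ls, Lb)]),
      (q, [(Ls, Lr, Lt)]),
      (p * q, [(Lr, Lt, Ls)]),
      (-p * q, [(Lr, Lt, Lt), (Lt, Lt, Lr)])]"
| "exceptions p q La =
     [(-1, [(Lr, Lb, Lr), (Ls, La, Lt), (Ls, Lb, Ls), (Ls, Lr, Lt), (Ls, Ls, Lt), (Lt, Ls, Lt),
        (Lt, Lt, Lr)]),
      (p, [(Lr, Ls, Lr), (Lr, Ls, Ls), (Lr, Lt, Ls), (Lt, La, Lr), (Lt, Lr, Lr)]),
      (-p, [(Lb, Ls, Lt), (Lb, Lt, Lr), (Lr, La, Ls), (Lr, Ls, Lb), (Ls, Lt, Lb), (Lt, Ls, Lr)]),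
      (q, [(Lt, Lr, Lt)]),
      (-p * q, [(Lr, Lt, Lr), (Ls, Lt, Lt), (Lt, Lt, Lt)])]"
| "exceptions p q Lb =
     [(-1, [(Lr, La, Lr), (Lr, Lr, Lr), (Ls, La, Ls), (Ls, Ls, Lr), (Ls, Ls, Ls), (Ls, Lt, Ls),
        (Lt, Lb, Ls), (Lt, Ls, Lt)]),
      (p, [(Lr, Lb, Lt), (Lr, Ls, Lt), (Lr, Lt, Lr), (Ls, Lr, Ls), (Ls, Lt, Lr)]),
      (-p, [(La, Lr, Lt), (Ls, Lb, Lr), (Ls, Lr, La), (Ls, Lr, Lr)]),
      (q, [(Lr, Lt, Lt)]),
      (p * q, [(Lt, Lt, Ls)]),
      (-p * q, [(Lr, Lr, Lt), (Lt, Lt, Lt)])]"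
| "exceptions p q Lr =
     [(-1, [(La, Lr, La), (La, Lr, Lr), (Lb, Lr, Lb), (Lb, Lt, La), (Lb, Lt, Lr), (Lr, La, Lr),
        (Lr, Lr, La), (Ls, Lb, Ls), (Ls, Lr, La), (Ls, Lt, La), (Lt, La, Lt), (Lt, Lb, Ls),
        (Lt, Lb, Lt), (Lt, Lr, Lb), (Lt, Lt, La)]),
      (p, [(Lr, La, Ls), (Ls, Lb, Lr), (Ls, Lr, Lb), (Lt, La, Lr)]),
      (-p, [(Lb, Lb, Lt), (Lr, Lb, Lt), (Lr, Ls, Lb), (Ls, Lb, Lb)]),
      (q, [(Lr, Lt, La)]),
      (-q, [(Lt, Lr, La)]),
      (p * q, [(La, Ls, Lt), (Lt, Ls, Lb)]),
      (-p * q, [(Lr, La, Lt), (Ls, Lb, Lt), (Lt, La, Ls), (Lt, Lb, Lr)])]"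
| "exceptions p q Ls =
     [(-1, [(La, Lt, Lb), (Lr, La, Lt), (Lr, Ls, La), (Lr, Lt, Lb), (Ls, Lb, Lt), (Ls, Lt, Lb),
        (Lt, La, Lr), (Lt, La, Ls), (Lt, Lb, Lr)]),
      (p, [(La, Ls, La), (La, Ls, Lr), (Lb, Ls, Lb), (Ls, Lb, Ls), (Ls, Ls, La), (Ls, Ls, Lb),
        (Lt, Ls, Lb)]),
      (-p, [(La, La, Lt), (La, Ls, Ls), (La, Ls, Lt), (Lb, La, Ls), (Lb, Lb, Lr), (Lb, Ls, Lr),
        (Lb, Ls, Ls), (Lr, La, Lr), (Ls, La, Ls), (Ls, Lb, La), (Ls, Lb, Lr), (Ls, Lr, La),
        (Lt, Lb, Ls)]),
      (q, [(Lr, Lr, La), (Lt, Lb, Lt)]),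
      (-q, [(Lb, Ls, Lt), (Lt, Lt, Lb)]),
      (p * q, [(Lr, Lb, Lr), (Ls, La, Lt)]),
      (-p * q, [(Lr, La, Ls), (Lr, Ls, Lb)])]"
| "exceptions p q Lt =
     [(-1, [(La, Lr, Lb), (Lb, Ls, La), (Lb, Ls, Lr), (Lr, La, Lr), (Lr, La, Ls), (Lr, Lb, Ls),
        (Ls, La, Lr), (Ls, Lb, Lr), (Ls, Lb, Ls), (Ls, Lb, Lt), (Ls, Lr, Lb), (Lt, La, Ls),
        (Lt, Lb, Ls), (Lt, Ls, La)]),
      (p, [(Lr, Lr, Lb), (Ls, Ls, La), (Lt, La, Lr), (Lt, La, Lt), (Lt, Lb, Lt)]),
      (-p, [(La, Lb, Lt), (La, Lt, La), (La, Lt, Lr), (La, Lt, Ls), (La, Lt, Lt), (Lb, Lt, Lb),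
        (Lb, Lt, Lr), (Lb, Lt, Ls), (Lr, Lb, Lb), (Lr, Lb, Lr), (Ls, La, La), (Ls, La, Ls),
        (Ls, La, Lt), (Ls, Lt, La), (Lt, La, Lb), (Lt, Lr, Lb), (Lt, Lt, Lb)]),
      (-q, [(Lb, Lt, Lt), (Lt, Lt, La)]),
      (p * q, [(La, Lr, Lt)]),
      (-p * q, [(Lr, Lt, Lb)])]"

definition F1 :: "real \<Rightarrow> real \<Rightarrow> label \<Rightarrow> label \<Rightarrow> label \<Rightarrow> label \<Rightarrow> real" where
  "F1 p q x y z u =
    (case find (\<lambda>(v, ws). (x, y, z) \<in> set ws) (exceptions p q u) of
       None \<Rightarrow> 1
     | Some (v, ws) \<Rightarrow> v)"

text \<open>
  The 3x3 matrices \<open>F\<^sub>u\<^sup>x\<^sup>y\<^sup>z\<close>, keyed by \<open>(x, y, z)\<close> and given as lists of rows; rows and columns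
  are both indexed by \<open>Lr, Ls, Lt\<close>.
\<close>

fun mats3 :: "real \<Rightarrow> real \<Rightarrow> label \<Rightarrow> ((label \<times> label \<times> label) \<times> real list list) list" where
  "mats3 p q Lr =
     [((Lr, Lr, Ls),
       [[nP, nM, -nC],
        [nM, nC, -nP],
        [nC, nP, -nM]]),
      ((Lr, Lr, Lt),
       [[nM, nC, -nP * p * q],
        [nC * p * q, nP * p * q, -nM],
        [nP, nM, -nC * p * q]]),
      ((Lr, Ls, Lr),
       [[nP, nM, nC],
        [nM, nC, nP],
        [-nC * p, -nP * p, -nM * p]]),
      ((Lr, Ls, Lt),
       [[-nC * p, nP, nM * p * q],
        [nP, -nM * p, -nC * q],
        [nM, -nC * p, -nP * q]]),
      ((Lr, Lt, Lr),
       [[nM, nC * p * q, nP],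
        [nC * p, nP * q, nM * p],
        [nP, nM * p * q, nC]]),
      ((Lr, Lt, Ls),
       [[-nC * p, nP * p * q, nM],
        [nP, -nM * q, -nC * p],
        [nM, -nC * q, -nP * p]]),
      ((Ls, Lr, Lr),
       [[nP, nM, -nC * p],
        [nM, nC, -nP * p],
        [-nC, -nP, nM * p]]),
      ((Ls, Lr, Ls),
       [[nM, -nC * p, nP],
        [-nC * p, nP, -nM * p],
        [-nP * p, nM, -nC * p]]),
      ((Ls, Ls, Ls),
       [[nC, nP, nM],
        [nP, nM, nC],
        [nM, nC, nP]]),
      ((Ls, Ls, Lt),
       [[nP, nM, nC * p * q],
        [nM, nC, nP * p * q],
        [nC, nP, nM * p * q]]),
      ((Ls, Lt, Lr),
       [[-nC * p, nP, nM],
        [nP * p, -nM, -nC],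
        [nM, -nC * p, -nP * p]]),
      ((Ls, Lt, Lt),
       [[nM * p * q, nC * p * q, nP],
        [nC, nP, nM * p * q],
        [nP, nM, nC * p * q]]),
      ((Lt, Lr, Lr),
       [[nM, nC * p, nP],
        [nC, nP * p, nM],
        [-nP * p * q, -nM * q, -nC * p * q]]),
      ((Lt, Lr, Lt),
       [[nP, -nM, -nC * q],
        [-nM * q, nC * q, nP],
        [-nC * q, nP * q, nM]]),
      ((Lt, Ls, Lr),
       [[-nC * p, nP, nM],
        [nP, -nM * p, -nC * p],
        [-nM * q, nC * p * q, nP * p * q]]),
      ((Lt, Ls, Ls),
       [[nP, nM, nC],
        [nM, nC, nP],
        [nC * p * q, nP * p * q, nM * p * q]]),
      ((Lt, Lt, Ls),
       [[nM * p * q, nC, nP],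
        [nC * p * q, nP, nM],
        [nP, nM * p * q, nC * p * q]]),
      ((Lt, Lt, Lt),
       [[nC, nP * p * q, nM],
        [nP * p * q, nM, nC * p * q],
        [nM, nC * p * q, nP]])]"
| "mats3 p q Ls =
     [((Lr, Lr, Lr),
       [[nP, nM, -nC * p],
        [nM, nC, -nP * p],
        [-nC * p * q, -nP * p * q, nM * q]]),
      ((Lr, Lr, Lt),
       [[-nC * q, nP, -nM],
        [nP, -nM * q, nC * q],
        [nM, -nC * q, nP * q]]),
      ((Lr, Ls, Lr),
       [[nM, -nC * p, -nP],
        [-nC * p, nP, nM * p],
        [nP * p * q, -nM * q, -nC * p * q]]),
      ((Lr, Ls, Ls),
       [[nC, nP, nM],
        [nP, nM, nC],
        [nM * p * q, nC * p * q, nP * p * q]]),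
      ((Lr, Lt, Ls),
       [[nP, nM * p * q, nC],
        [nM, nC * p * q, nP],
        [nC * p * q, nP, nM * p * q]]),
      ((Lr, Lt, Lt),
       [[nM, nC, nP * p * q],
        [nC * p * q, nP * p * q, nM],
        [nP, nM, nC * p * q]]),
      ((Ls, Lr, Ls),
       [[nC, nP, -nM * p],
        [nP, nM, -nC * p],
        [nM, nC, -nP * p]]),
      ((Ls, Lr, Lt),
       [[nP * p * q, nM, -nC * p],
        [nM, nC * p * q, -nP * q],
        [nC * p * q, nP, -nM * p]]),
      ((Ls, Ls, Lr),
       [[nC, nP, nM * p],
        [nP, nM, nC * p],
        [-nM * p, -nC * p, -nP]]),
      ((Ls, Ls, Lt),
       [[nM * p * q, -nC * p, -nP * p],
        [-nC * q, nP, nM],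
        [-nP * q, nM, nC]]),
      ((Ls, Lt, Lr),
       [[nP, nM, nC * p],
        [nM * p, nC * p, nP],
        [nC, nP, nM * p]]),
      ((Ls, Lt, Ls),
       [[nM, -nC * p, -nP * p],
        [-nC * p, nP, nM],
        [-nP * p, nM, nC]]),
      ((Lt, Lr, Lr),
       [[-nC, nP, nM],
        [nP, -nM, -nC],
        [-nM, nC, nP]]),
      ((Lt, Lr, Ls),
       [[nP * p, nM, nC * p],
        [nM, nC * p, nP],
        [nC, nP * p, nM]]),
      ((Lt, Ls, Ls),
       [[nM * p, -nC, -nP],
        [-nC * p, nP, nM],
        [-nP * p, nM, nC]]),
      ((Lt, Ls, Lt),
       [[nC * q, -nP, -nM],
        [-nP * q, nM, nC],
        [-nM * q, nC, nP]]),
      ((Lt, Lt, Lr),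
       [[nM * q, nC * p, nP],
        [nC * q, nP * p, nM],
        [nP * p * q, nM, nC * p]]),
      ((Lt, Lt, Lt),
       [[nP * q, -nM * p * q, -nC * p * q],
        [-nM * p, nC, nP],
        [-nC * p, nP, nM]])]"
| "mats3 p q Lt =
     [((Lr, Lr, Lr),
       [[nM, nC * p, nP],
        [-nC, -nP * p, -nM],
        [nP, nM * p, nC]]),
      ((Lr, Lr, Ls),
       [[nC * p, -nP, nM],
        [nP, -nM * p, nC * p],
        [nM, -nC * p, nP * p]]),
      ((Lr, Ls, Ls),
       [[-nP, -nM, -nC],
        [nM, nC, nP],
        [nC, nP, nM]]),
      ((Lr, Ls, Lt),
       [[-nM, -nC, -nP],
        [nC, nP, nM],
        [nP, nM, nC]]),
      ((Lr, Lt, Lr),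
       [[nP, -nM * p * q, nC * p],
        [nM, -nC * p * q, nP * p],
        [nC * p, -nP * q, nM]]),
      ((Lr, Lt, Lt),
       [[-nC * p * q, -nP, -nM * p * q],
        [nP, nM * p * q, nC],
        [nM, nC * p * q, nP]]),
      ((Ls, Lr, Lr),
       [[-nC, nP, nM],
        [-nP, nM, nC],
        [nM, -nC, -nP]]),
      ((Ls, Lr, Lt),
       [[-nM * p, -nC * p, nP],
        [nC * p * q, nP * p * q, -nM * q],
        [nP, nM, -nC * p]]),
      ((Ls, Ls, Lr),
       [[nP * p, nM, -nC * p],
        [-nM, -nC * p, nP],
        [nC * p, nP, -nM * p]]),
      ((Ls, Ls, Ls),
       [[-nM * p, nC, nP],
        [-nC * p, nP, nM],
        [-nP * p, nM, nC]]),
      ((Ls, Lt, Ls),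
       [[-nC * p, nP, nM],
        [-nP * p, nM, nC],
        [-nM * p, nC, nP]]),
      ((Ls, Lt, Lt),
       [[-nP * q, nM * p * q, nC * p * q],
        [-nM * p, nC, nP],
        [-nC * p, nP, nM]]),
      ((Lt, Lr, Ls),
       [[nM, nC * p, nP],
        [nC, nP * p, nM],
        [nP, nM * p, nC]]),
      ((Lt, Lr, Lt),
       [[nC, nP * p, nM],
        [nP * p * q, nM * q, nC * p * q],
        [nM, nC * p, nP]]),
      ((Lt, Ls, Lr),
       [[-nM, -nC * p, nP],
        [-nC, -nP * p, nM],
        [nP * p, nM, -nC * p]]),
      ((Lt, Ls, Lt),
       [[nP, -nM * p, -nC * p],
        [-nM * p, nC, nP],
        [-nC * p, nP, nM]]),
      ((Lt, Lt, Lr),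
       [[-nC * p * q, -nP * p, nM],
        [-nP * q, -nM, nC * p],
        [-nM * p * q, -nC * p, nP]]),
      ((Lt, Lt, Ls),
       [[nP * p * q, -nM * p, -nC * p],
        [-nM * q, nC, nP],
        [-nC * q, nP, nM]])]"
| "mats3 p q _ = []"

text \<open>
  The 4x4 matrices, in the form \<open>((x, y, z), (g, h), rows)\<close>: rows are indexed by
  \<open>g, Lr, Ls, Lt\<close> and columns by \<open>h, Lr, Ls, Lt\<close>, where \<open>g\<close> is the invertible label in \<open>y \<otimes> z\<close>
  and \<open>h\<close> the one in \<open>x \<otimes> y\<close>.
\<close>

fun mats4 ::
  "real \<Rightarrow> real \<Rightarrow> label \<Rightarrow>
    ((label \<times> label \<times> label) \<times> (label \<times> label) \<times> real list list) list" where
  "mats4 p q Lr =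
     [((Lr, Lr, Lr), (L1, L1),
       [[nA, nS, -nS * p, nS * p],
        [nS, -nB, -nP * p, nM * p],
        [-nS * p, -nP * p, nM, nB],
        [nS * p, nM * p, nB, nP]]),
      ((Lr, Ls, Ls), (L1, Lb),
       [[nA, -nS * p, nS, nS],
        [nS, -nM * p, -nB, nP],
        [-nS * p, -nB, -nP * p, -nM * p],
        [-nS * p, nP, -nM * p, nB * p]]),
      ((Lr, Lt, Lt), (L1, La),
       [[nA, nS * p, -nS * p * q, -nS * p * q],
        [-nS * p * q, -nP * q, nM, -nB],
        [nS * p, nM, nB * q, -nP * q],
        [nS * p, -nB, -nP * q, -nM * q]]),
      ((Ls, Lr, Lt), (La, La),
       [[-nA, nS * p, -nS, nS * q],
        [-nS * p, -nB, -nP * p, nM * p * q],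
        [nS * p * q, -nP * q, nM * p * q, nB * p],
        [nS, -nM * p, -nB, -nP * q]]),
      ((Ls, Ls, Lr), (La, L1),
       [[nA, nS, -nS * p, -nS * p],
        [-nS * p, -nM * p, -nB, nP],
        [nS, -nB, -nP * p, -nM * p],
        [-nS * p, -nP * p, nM, -nB]]),
      ((Ls, Lt, Ls), (La, Lb),
       [[-nA, -nS * p, -nS * p, -nS * p],
        [nS * p, nP, nM, -nB],
        [nS * p, nM, -nB, nP],
        [nS * p, -nB, nP, nM]]),
      ((Lt, Lr, Ls), (Lb, Lb),
       [[-nA, nS * p, -nS * p, -nS],
        [-nS * p, -nB, -nP, -nM * p],
        [nS, -nP * p, nM * p, -nB],
        [nS * p * q, -nM * q, -nB * q, nP * p * q]]),
      ((Lt, Ls, Lt), (Lb, La),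
       [[nA, -nS * p, -nS * p, -nS * q],
        [-nS * p, nM, -nB, nP * p * q],
        [-nS * p, -nB, nP, nM * p * q],
        [-nS * q, nP * p * q, nM * p * q, -nB]]),
      ((Lt, Lt, Lr), (Lb, L1),
       [[nA, -nS * p * q, nS * p, nS * p],
        [nS * p, -nP * q, nM, -nB],
        [-nS * p, nM * q, nB, -nP],
        [-nS * p * q, -nB, -nP * q, -nM * q]])]"
| "mats4 p q Ls =
     [((Lr, Lr, Ls), (Lb, L1),
       [[nA, nS, -nS * p, nS * p],
        [-nS * p, -nM * p, -nB, -nP],
        [nS, -nB, -nP * p, nM * p],
        [nS * p * q, nP * p * q, -nM * q, -nB * q]]),
      ((Lr, Ls, Lt), (Lb, Lb),
       [[nA * p, nS * q, nS * p, nS * p],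
        [nS, nP * p * q, nM, -nB],
        [nS, nM * p * q, -nB, nP],
        [nS * p * q, -nB, nP * p * q, nM * p * q]]),
      ((Lr, Lt, Lr), (Lb, La),
       [[-nA, -nS * p, nS * p * q, nS * p],
        [nS * p, -nB, -nP * q, -nM],
        [-nS * p, -nP, nM * q, -nB],
        [-nS * p * q, -nM * q, -nB, nP * q]]),
      ((Ls, Lr, Lr), (L1, La),
       [[nA, -nS * p, nS, -nS],
        [nS, -nM * p, -nB, -nP],
        [-nS * p, -nB, -nP * p, nM * p],
        [nS * p, -nP, nM * p, nB * p]]),
      ((Ls, Ls, Ls), (L1, L1),
       [[nA, nS, -nS * p, -nS * p],
        [nS, nP, -nM * p, nB * p],
        [-nS * p, -nM * p, -nB, nP],
        [-nS * p, nB * p, nP, nM]]),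
      ((Ls, Lt, Lt), (L1, Lb),
       [[nA, -nS * p * q, nS * p, nS * p],
        [-nS * p * q, -nB, -nP * q, -nM * q],
        [nS * p, -nP * q, nM, -nB],
        [nS * p, -nM * q, -nB, nP]]),
      ((Lt, Lr, Lt), (La, Lb),
       [[nA, nS * p * q, nS * p, nS],
        [nS * p, nM * q, -nB, nP * p],
        [nS * p * q, -nB, nP * q, nM * p * q],
        [nS, nP * p * q, nM * p, -nB]]),
      ((Lt, Ls, Lr), (La, La),
       [[nA * p, -nS, -nS, -nS * p],
        [-nS, nP * p, nM * p, -nB],
        [-nS * p, nM, -nB, nP * p],
        [nS, nB * p, -nP * p, -nM]]),
      ((Lt, Lt, Ls), (La, L1),
       [[nA, -nS * p * q, nS * p, nS * p],
        [-nS * p, -nB * q, -nP, -nM],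
        [nS * p, -nP * q, nM, -nB],
        [nS * p, -nM * q, -nB, nP]])]"
| "mats4 p q Lt =
     [((Lr, Lr, Lt), (La, L1),
       [[nA, nS, -nS * p, nS * p],
        [nS * p, nP * p, -nM, -nB],
        [nS * p * q, nM * p * q, nB * q, nP * q],
        [nS, -nB, -nP * p, nM * p]]),
      ((Lr, Ls, Lr), (La, Lb),
       [[-nA, -nS * p, nS * p, -nS],
        [nS * p, -nB, -nP, nM * p],
        [nS, nP * p, -nM * p, -nB],
        [-nS * p, -nM, -nB, -nP * p]]),
      ((Lr, Lt, Ls), (La, La),
       [[-nA * p, nS * p, nS * q, nS * p],
        [nS, -nM, nB * p * q, -nP],
        [-nS, -nB, nP * p * q, nM],
        [-nS, nP, nM * p * q, -nB]]),
      ((Ls, Lr, Ls), (Lb, La),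
       [[-nA, -nS, -nS, nS * p],
        [-nS * p, -nP * p, -nM * p, -nB],
        [nS, nM, -nB, -nP * p],
        [nS, -nB, nP, -nM * p]]),
      ((Ls, Ls, Lt), (Lb, L1),
       [[nA, nS, -nS * p, -nS * p],
        [-nS * p, nB * p, nP, nM],
        [-nS * p, -nP * p, nM, -nB],
        [-nS * p, -nM * p, -nB, nP]]),
      ((Ls, Lt, Lr), (Lb, Lb),
       [[-nA * p, nS, nS * p, -nS],
        [-nS, nM * p, -nB, -nP * p],
        [nS, nB * p, -nP, nM * p],
        [nS * p, -nP, -nM * p, -nB]]),
      ((Lt, Lr, Lr), (L1, Lb),
       [[nA, nS * p, -nS, nS],
        [nS, nP * p, -nM, -nB],
        [-nS * p, -nM, -nB * p, -nP * p],
        [nS * p, -nB, -nP * p, nM * p]]),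
      ((Lt, Ls, Ls), (L1, La),
       [[nA, nS, -nS * p, -nS * p],
        [nS, -nB, -nP * p, -nM * p],
        [-nS * p, -nP * p, nM, -nB],
        [-nS * p, -nM * p, -nB, nP]]),
      ((Lt, Lt, Lt), (L1, L1),
       [[nA, -nS * p * q, nS * p, nS * p],
        [-nS * p * q, nM, nB * q, -nP * q],
        [nS * p, nB * q, nP, nM],
        [nS * p, -nP * q, nM, -nB]])]"
| "mats4 p q _ = []"

definition mat_entry :: "label list \<Rightarrow> label list \<Rightarrow> real list list \<Rightarrow> label \<Rightarrow> label \<Rightarrow> real" where
  "mat_entry rs cs m j k = the (map_of (zip cs (the (map_of (zip rs m) j))) k)"

text \<open>
  \<open>F p q x y z u j k\<close> is the entry of \<open>F\<^sub>u\<^sup>x\<^sup>y\<^sup>z\<close> in row \<open>j\<close> and column \<open>k\<close>, with sign parameters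
  \<open>p\<close> and \<open>q\<close>.  It is 0 if \<open>j\<close> is not a row label or \<open>k\<close> not a column label of that matrix.  The
  pentagon equations rely on this convention: on their left-hand side the two factors share the
  intermediate vertex \<open>a \<otimes> c \<rightarrow> u\<close>, and \<open>N a c u = 1\<close> does not follow from the multiplicity
  conditions under which the equation is stated.
\<close>

definition F ::
  "real \<Rightarrow> real \<Rightarrow> label \<Rightarrow> label \<Rightarrow> label \<Rightarrow> label \<Rightarrow> label \<Rightarrow> label \<Rightarrow> real" where
  "F p q x y z u j k =
    (if N y z j = 1 \<and> N x j u = 1 \<and> N x y k = 1 \<and> N k z u = 1 then
       if invertible x \<or> invertible y \<or> invertible z \<or> invertible u then F1 p q x y z u
       else
         (case map_of (mats4 p q u) (x, y, z) of
            Some ((g, h), m) \<Rightarrow> mat_entry [g, Lr, Ls, Lt] [h, Lr, Ls, Lt] m j k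
          | None \<Rightarrow>
              mat_entry [Lr, Ls, Lt] [Lr, Ls, Lt] (the (map_of (mats3 p q u) (x, y, z))) j k)
     else 0)"

end

theory Submission
  imports Defs
begin

text \<open>
  Up to a change of sign of the trivalent vertices (\<open>gauge\<close>), an entry of a matrix depends only
  on which of its six labels are invertible and on their exponents modulo 3, and not on \<open>p\<^sub>1\<close> and
  \<open>p\<^sub>2\<close>: if every label is some \<open>\<alpha>\<^sup>i\<rho>\<close>, then the sum of the six exponents decides between \<open>C\<close>
  (or \<open>- B\<close> in a 4x4 matrix), \<open>D\<^sub>+\<close> and \<open>D\<^sub>-\<close> (\<open>tetra\<close>).  The signs cancel in the pentagon equations.  The gauged symbols are
  invariant under replacing each strand \<open>x\<close> by \<open>\<alpha>\<^sup>i \<otimes> x \<otimes> \<alpha>\<^sup>-\<^sup>j\<close>, where \<open>i\<close> and \<open>j\<close> belong to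
  the regions on its two sides.  This moves \<open>x\<close>, \<open>y\<close>, \<open>z\<close> and \<open>w\<close> into \<open>{1, \<rho>}\<close>, leaving a few
  hundred equations, which hold because \<open>A\<close>, \<open>B\<close>, \<open>D\<^sub>-\<close> and the squares of \<open>S\<close>, \<open>C\<close>, \<open>D\<^sub>+\<close> are
  polynomials in \<open>C\<close> and \<open>D\<^sub>+\<close>.
\<close>

section \<open>Fusion channels\<close>

definition channels :: "label \<Rightarrow> label \<Rightarrow> label set" where
  "channels x y = {z. N x y z = 1}"

lemma channels_eq_fusion: "channels x y = set_mset (fusion x y)"
  by (auto simp: channels_def N_def fusion_def inv_lab_def rho_lab_def split: if_splits)

lemma channels_table:
  "channels L1 y = {y}" "channels x L1 = {x}"
  "channels La La = {Lb}" "channels La Lb = {L1}"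
  "channels Lb La = {L1}" "channels Lb Lb = {La}"
  "channels La Lr = {Ls}" "channels La Ls = {Lt}" "channels La Lt = {Lr}"
  "channels Lb Lr = {Lt}" "channels Lb Ls = {Lr}" "channels Lb Lt = {Ls}"
  "channels Lr La = {Lt}" "channels Lr Lb = {Ls}"
  "channels Ls La = {Lr}" "channels Ls Lb = {Lt}"
  "channels Lt La = {Ls}" "channels Lt Lb = {Lr}"
  "channels Lr Lr = {L1, Lr, Ls, Lt}"
  "channels Lr Ls = {Lb, Lr, Ls, Lt}"
  "channels Lr Lt = {La, Lr, Ls, Lt}"
  "channels Ls Lr = {La, Lr, Ls, Lt}"
  "channels Ls Ls = {L1, Lr, Ls, Lt}"
  "channels Ls Lt = {Lb, Lr, Ls, Lt}"
  "channels Lt Lr = {Lb, Lr, Ls, Lt}"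
  "channels Lt Ls = {La, Lr, Ls, Lt}"
  "channels Lt Lt = {L1, Lr, Ls, Lt}"
  subgoal by (cases y) (auto simp: channels_eq_fusion fusion_def inv_lab_def rho_lab_def invertible_def)
  subgoal by (cases x) (auto simp: channels_eq_fusion fusion_def inv_lab_def rho_lab_def invertible_def)
  by (auto simp: channels_eq_fusion fusion_def inv_lab_def rho_lab_def invertible_def)

text \<open>As a congruence rule, this keeps the simplifier out of the body until the bound variable is known.\<close>

lemma ball_weak_cong: "A = B \<Longrightarrow> (\<forall>x\<in>A. P x) \<longleftrightarrow> (\<forall>x\<in>B. P x)"
  by simp

lemmas expand_simps = channels_table UNIV_label ball_simps(5,7) insert_iff empty_iff label.distinct simp_thms

section \<open>The gauge\<close>

text \<open>
  These signs solve the linear system over \<open>\<int>/2\<close> which says that gauging makes every entry equal to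
  the one prescribed by \<open>tetra\<close>; of the solutions, this one has few signs different from 1.
\<close>

definition gauge :: "real \<Rightarrow> real \<Rightarrow> label \<Rightarrow> label \<Rightarrow> label \<Rightarrow> real" where
  "gauge p q x y z =
    (if (x, y, z) \<in> {(La, Lr, Ls), (La, Ls, Lt), (Lb, Ls, Lr), (Lr, Lr, Ls), (Ls, Lr, La),
        (Ls, Lr, Lt), (Ls, Ls, L1), (Ls, Ls, Lr), (Ls, Lt, Lr), (Lt, Ls, Lr)} then - p
     else if (x, y, z) \<in> {(Lr, La, Lt), (Lr, Lr, Lt), (Lr, Lt, La), (Ls, Lt, Lb), (Lt, La, Ls),
        (Lt, Lb, Lr), (Lt, Lr, Ls), (Lt, Lt, L1)} then p
     else if (x, y, z) = (Lr, Lt, Ls) then p * q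
     else if (x, y, z) = (Ls, Lb, Lt) then - 1
     else if (x, y, z) = (Lt, Lt, Lr) then - q
     else 1)"

lemma gauge_cancel:
  assumes "p * p = 1" "q * q = 1"
  shows "gauge p q x y z * gauge p q x y z = 1"
    and "gauge p q x y z * (gauge p q x y z * v) = v"
proof -
  show "gauge p q x y z * gauge p q x y z = 1"
    using assms by (simp add: gauge_def mult.assoc mult.left_commute[of q p])
  then show "gauge p q x y z * (gauge p q x y z * v) = v"
    by (simp flip: mult.assoc)
qed

text \<open>For noninvertible \<open>x\<close>, \<open>y\<close>, \<open>z\<close>,
  \<open>u\<close>, the last divisibility test detects the 4x4 matrices: \<open>x\<close> times the
  invertible label in the product of \<open>y\<close> and \<open>z\<close> is then
  \<open>u\<close>.\<close>

definition tetra :: "label \<Rightarrow> label \<Rightarrow> label \<Rightarrow> label \<Rightarrow> label \<Rightarrow> label \<Rightarrow> real" where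
  "tetra x y z u j k =
    (if k \<in> channels x y \<and> u \<in> channels k z \<and> j \<in> channels y z \<and> u \<in> channels x j then
       if invertible x \<or> invertible y \<or> invertible z \<or> invertible u then 1
       else if invertible j \<and> invertible k then nA
       else if invertible j \<or> invertible k then nS
       else if 3 dvd expo x + expo y + expo z + expo u + expo j + expo k - 1 then nP
       else if 3 dvd expo x + expo y + expo z + expo u + expo j + expo k - 2 then nM
       else if 3 dvd expo x - expo y + expo z - expo u then - nB else nC
     else 0)"

text \<open>This is the body of \<open>F\<close> without its guard, which the quantifier ranges of
  the next lemma guarantee.\<close>

definition entry ::
  "real \<Rightarrow> real \<Rightarrow> label \<Rightarrow> label \<Rightarrow> label \<Rightarrow> label \<Rightarrow> label \<Rightarrow> label \<Rightarrow> real" where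
  "entry p q x y z u j k =
    (if invertible x \<or> invertible y \<or> invertible z \<or> invertible u then F1 p q x y z u
     else case map_of (mats4 p q u) (x, y, z) of
        Some ((g, h), m) \<Rightarrow> mat_entry [g, Lr, Ls, Lt] [h, Lr, Ls, Lt] m j k
      | None \<Rightarrow> mat_entry [Lr, Ls, Lt] [Lr, Ls, Lt] (the (map_of (mats3 p q u) (x, y, z))) j k)"

text \<open>A finite check: in this quantifier order every range is an explicit set once the labels
  before it are fixed.\<close>

lemma entry_eq_gauge_tetra:
  assumes pq: "p * p = 1" "q * q = 1"
  shows "\<forall>x\<in>UNIV. \<forall>y\<in>UNIV. \<forall>k\<in>channels x y. \<forall>z\<in>UNIV. \<forall>u\<in>channels k z. \<forall>j\<in>channels y z.
    u \<in> channels x j \<longrightarrow> entry p q x y z u j k =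
      gauge p q x y k * gauge p q k z u * gauge p q y z j * gauge p q x j u * tetra x y z u j k"
proof -
  have pq': "p * (p * v) = v" "q * (q * v) = v" for v
    using pq by (simp_all flip: mult.assoc)
  show ?thesis
    by (simp only: expand_simps cong: ball_weak_cong,
      simp only: entry_def F1_def exceptions.simps mats4.simps mats3.simps map_of.simps find.simps
        insert_iff empty_iff list.set case_prod_conv prod.inject label.distinct simp_thms if_True
        if_False option.case option.sel fst_conv snd_conv fun_upd_apply mat_entry_def zip_Cons_Cons
        invertible_def,
      simp only: gauge_def tetra_def expand_simps prod.inject invertible_def if_True if_False,
      simp add: pq pq' mult_ac)
qed

lemma F_eq_gauge_tetra:
  assumes "p * p = 1" "q * q = 1"
  shows "F p q x y z u j k =
    gauge p q x y k * gauge p q k z u * gauge p q y z j * gauge p q x j u * tetra x y z u j k"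
proof (cases "k \<in> channels x y \<and> u \<in> channels k z \<and> j \<in> channels y z \<and> u \<in> channels x j")
  case True
  then have "F p q x y z u j k = entry p q x y z u j k"
    by (simp add: channels_def F_def entry_def)
  then show ?thesis
    using entry_eq_gauge_tetra[OF assms] True by simp
next
  case False
  then show ?thesis
    by (auto simp: channels_def F_def tetra_def)
qed

section \<open>Bimodule symmetry\<close>

lemma N_iff:
  "N x y z = 1 \<longleftrightarrow>
    (if invertible x then invertible z = invertible y \<and> 3 dvd expo x + expo y - expo z
     else if invertible y then \<not> invertible z \<and> 3 dvd expo x - expo y - expo z
     else invertible z \<longrightarrow> 3 dvd expo x - expo y - expo z)"
  by (cases x; cases y; cases z; simp add: N_def fusion_def inv_lab_def rho_lab_def invertible_def)

definition lab :: "bool \<Rightarrow> int \<Rightarrow> label" where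
  "lab s n = (if s then inv_lab n else rho_lab n)"

lemma invertible_lab [simp]: "invertible (lab s n) = s"
  by (simp add: lab_def inv_lab_def rho_lab_def invertible_def)

lemma expo_lab [simp]: "expo (lab s n) = n mod 3"
proof -
  have "n mod 3 = 0 \<or> n mod 3 = 1 \<or> n mod 3 = 2"
    by presburger
  then show ?thesis
    by (auto simp: lab_def inv_lab_def rho_lab_def)
qed

lemma lab_invertible_expo [simp]: "lab (invertible x) (expo x) = x"
  by (cases x) (simp_all add: lab_def inv_lab_def rho_lab_def invertible_def)

lemma lab_mod: "lab s (n mod 3) = lab s n"
  by (simp add: lab_def inv_lab_def rho_lab_def)

text \<open>The sign of \<open>j\<close> depends on \<open>x\<close> because \<rho> \<otimes>
  \<alpha> = \<alpha>* \<otimes> \<rho>.\<close>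

definition act :: "int \<Rightarrow> label \<Rightarrow> int \<Rightarrow> label" where
  "act i x j = lab (invertible x) (if invertible x then expo x + i - j else expo x + i + j)"

lemma invertible_act [simp]: "invertible (act i x j) = invertible x"
  by (simp add: act_def)

lemma expo_act:
  "expo (act i x j) = (if invertible x then expo x + i - j else expo x + i + j) mod 3"
  by (simp add: act_def)

lemma act_inverse: "act (- i) (act i x j) (- j) = x"
proof -
  have "lab s (n mod 3 - i + j) = lab s (n - i + j)"
    "lab s (n mod 3 - i - j) = lab s (n - i - j)" for n s
    by (metis lab_mod mod_add_left_eq mod_diff_left_eq)+
  then show ?thesis
    using lab_invertible_expo[of x] by (cases "invertible x") (simp_all add: act_def)
qed

lemma bij_act: "bij (\<lambda>x. act i x j)"
  by (rule o_bij[of "\<lambda>x. act (- i) x (- j)"])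
    (use act_inverse[of i _ j] act_inverse[of "- i" _ "- j"] in \<open>auto simp: fun_eq_iff\<close>)

lemma act_normalize: "\<exists>j. act i x j = lab (invertible x) 0"
proof (cases "invertible x")
  case True
  then show ?thesis by (intro exI[of _ "expo x + i"]) (simp add: act_def)
next
  case False
  then show ?thesis by (intro exI[of _ "- expo x - i"]) (simp add: act_def)
qed

lemma dvd_iff_of_mod_eq: "x mod m = y mod m \<Longrightarrow> m dvd x \<longleftrightarrow> m dvd y" for m x y :: int
  by (simp only: dvd_eq_mod_eq_0)

lemma dvd_mod_simps:
  "(3::int) dvd a mod 3 + b mod 3 - c mod 3 \<longleftrightarrow> 3 dvd a + b - c"
  "(3::int) dvd a mod 3 - b mod 3 - c mod 3 \<longleftrightarrow> 3 dvd a - b - c"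
  "(3::int) dvd a mod 3 - b mod 3 + c mod 3 - d mod 3 \<longleftrightarrow> 3 dvd a - b + c - d"
  "(3::int) dvd a mod 3 + b mod 3 + c mod 3 + d mod 3 + e mod 3 + f mod 3 - m \<longleftrightarrow>
    3 dvd a + b + c + d + e + f - m"
  by (rule dvd_iff_of_mod_eq, intro mod_add_cong mod_diff_cong mod_mod_trivial refl)+

text \<open>The two powers of \<alpha> attached to the middle region \<open>j\<close> cancel in the
  product.\<close>

lemma N_act: "N (act i x j) (act j y k) (act i z k) = 1 \<longleftrightarrow> N x y z = 1"
  unfolding N_iff invertible_act expo_act
  by (cases "invertible x"; cases "invertible y"; cases "invertible z";
    simp only: if_True if_False simp_thms dvd_mod_simps; simp add: algebra_simps)

lemma channels_act: "act i z k \<in> channels (act i x j) (act j y k) \<longleftrightarrow> z \<in> channels x y"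
  by (simp only: channels_def mem_Collect_eq N_act)

text \<open>Each of the four regions borders three of the six strands, so for noninvertible strands
  the exponent sum changes by a multiple of 3; in the alternating sum of the outer exponents the
  shifts cancel.\<close>

lemma tetra_act:
  "tetra (act i x j) (act j y k) (act k z l) (act i u l) (act j r l) (act i c k)
    = tetra x y z u r c"
proof -
  have *: "3 dvd (a + i + j) + (b + j + k) + (c + k + l) + (d + i + l) + (e + j + l) + (f + i + k) - m
    \<longleftrightarrow> 3 dvd a + b + c + d + e + f - m" for a b c d e f m :: int
  proof -
    have "(a + i + j) + (b + j + k) + (c + k + l) + (d + i + l) + (e + j + l) + (f + i + k) - m
      = (a + b + c + d + e + f - m) + (i + j + k + l) * 3"
      by simp
    then show ?thesis
      by (simp only: dvd_add_times_triv_right_iff)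
  qed
  have **: "(a + i + j) - (b + j + k) + (c + k + l) - (d + i + l) = a - b + c - d" for a b c d :: int
    by simp
  show ?thesis
    unfolding tetra_def channels_act invertible_act expo_act
    by (cases "invertible x \<or> invertible y \<or> invertible z \<or> invertible u";
        cases "invertible r \<or> invertible c")
      (simp_all only: de_Morgan_disj if_True if_False simp_thms dvd_mod_simps * **)
qed

definition pentagon ::
  "(label \<Rightarrow> label \<Rightarrow> label \<Rightarrow> label \<Rightarrow> label \<Rightarrow> label \<Rightarrow> real) \<Rightarrow>
    label \<Rightarrow> label \<Rightarrow> label \<Rightarrow> label \<Rightarrow> label \<Rightarrow> label \<Rightarrow> label \<Rightarrow> label \<Rightarrow> label \<Rightarrow> bool" where
  "pentagon f x y z w u a b c d \<longleftrightarrow>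
    f x y c u d a * f a z w u c b = (\<Sum>e\<in>UNIV. f y z w d c e * f x e w u d b * f x y z b e a)"

lemma pentagon_tetra_act:
  "pentagon tetra (act i x j) (act j y k) (act k z l) (act l w m)
      (act i u m) (act i a k) (act i b l) (act k c m) (act j d m)
    \<longleftrightarrow> pentagon tetra x y z w u a b c d"
  unfolding pentagon_def
  \<comment> \<open>The internal strand \<open>e\<close> separates the regions \<open>j\<close> and
    \<open>l\<close>.\<close>
  by (subst sum.reindex_bij_betw[OF bij_act[of j l], symmetric]) (simp add: tetra_act)

section \<open>The pentagon equations\<close>

text \<open>\<open>nP\<close> and \<open>nM\<close> are the roots of
  \<open>T^2 - (1 - nC) * T - nB / 3\<close>. These rules reduce every polynomial in the constants
  to degree at most 1 in each of \<open>nS\<close>, \<open>nC\<close>, \<open>nP\<close>.\<close>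

lemma constants:
  shows nA_eq: "nA = 3 * nC - 2" and nB_eq: "nB = 2 * nC - 1" and nM_eq: "nM = 1 - nC - nP"
    and nS_sq: "nS * nS = 3 * nC - 2" and nC_sq: "nC * nC = (nC + 1) / 3"
    and nP_sq: "nP * nP = (1 - nC) * nP + (2 * nC - 1) / 3"
proof -
  have w: "sqrt 13 * sqrt 13 = (13::real)" by simp
  have t: "sqrt (6 * (sqrt 13 + 1)) * sqrt (6 * (sqrt 13 + 1)) = 6 * (sqrt 13 + 1)"
    by simp
  have "3 \<le> sqrt (13::real)"
    by (rule real_le_rsqrt) simp
  then have "nS * nS = nA"
    by (simp add: nS_def nA_def)
  then show "nS * nS = 3 * nC - 2"
    by (simp add: nA_def nC_def field_simps)
  show "nA = 3 * nC - 2" "nB = 2 * nC - 1" "nM = 1 - nC - nP"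
    by (simp_all add: nA_def nB_def nC_def nM_def nP_def field_simps)
  show "nC * nC = (nC + 1) / 3"
    using w by (simp add: nC_def field_simps)
  show "nP * nP = (1 - nC) * nP + (2 * nC - 1) / 3"
    using w t unfolding nP_def nC_def by (simp add: field_simps)
qed

lemma square_mult: "a * a = b \<Longrightarrow> a * (a * c) = b * (c::real)"
  by (simp flip: mult.assoc)

lemma sum_label:
  "(\<Sum>e\<in>UNIV. f e) = f L1 + (f La + (f Lb + (f Lr + (f Ls + f Lt))))"
  for f :: "label \<Rightarrow> real"
  by (simp add: UNIV_label)

lemma pentagon_tetra_base:
  "\<forall>x\<in>{L1, Lr}. \<forall>y\<in>{L1, Lr}. \<forall>z\<in>{L1, Lr}. \<forall>w\<in>{L1, Lr}.
    \<forall>a\<in>channels x y. \<forall>b\<in>channels a z. \<forall>u\<in>channels b w. \<forall>c\<in>channels z w. \<forall>d\<in>channels y c.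
    u \<in> channels x d \<longrightarrow> pentagon tetra x y z w u a b c d"
  by (simp only: expand_simps cong: ball_weak_cong,
    simp only: pentagon_def sum_label tetra_def channels_table insert_iff empty_iff label.distinct
      simp_thms invertible_def if_True if_False,
    simp,
    simp add: nA_eq nB_eq nM_eq algebra_simps nS_sq nC_sq nP_sq square_mult[OF nS_sq]
      square_mult[OF nC_sq] square_mult[OF nP_sq] add_divide_distrib diff_divide_distrib)

lemma lab_0: "lab s 0 \<in> {L1, Lr}"
  by (simp add: lab_def inv_lab_def rho_lab_def)

lemma pentagon_tetra:
  assumes "a \<in> channels x y" "b \<in> channels a z" "u \<in> channels b w"
    and "c \<in> channels z w" "d \<in> channels y c" "u \<in> channels x d"
  shows "pentagon tetra x y z w u a b c d"
proof -
  \<comment> \<open>From left to right, the first region gets 0 and each further one is chosen to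
    normalize the strand on its left.\<close>
  obtain j where j: "act 0 x j = lab (invertible x) 0" using act_normalize by blast
  obtain k where k: "act j y k = lab (invertible y) 0" using act_normalize by blast
  obtain l where l: "act k z l = lab (invertible z) 0" using act_normalize by blast
  obtain m where m: "act l w m = lab (invertible w) 0" using act_normalize by blast
  have "act 0 x j \<in> {L1, Lr}" "act j y k \<in> {L1, Lr}" "act k z l \<in> {L1, Lr}" "act l w m \<in> {L1, Lr}"
    unfolding j k l m by (rule lab_0)+
  moreover have "act 0 a k \<in> channels (act 0 x j) (act j y k)"
    "act 0 b l \<in> channels (act 0 a k) (act k z l)" "act 0 u m \<in> channels (act 0 b l) (act l w m)"
    "act k c m \<in> channels (act k z l) (act l w m)" "act j d m \<in> channels (act j y k) (act k c m)"
    "act 0 u m \<in> channels (act 0 x j) (act j d m)"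
    using assms by (simp_all only: channels_act)
  ultimately have "pentagon tetra (act 0 x j) (act j y k) (act k z l) (act l w m) (act 0 u m)
      (act 0 a k) (act 0 b l) (act k c m) (act j d m)"
    using pentagon_tetra_base by blast
  then show ?thesis
    by (simp only: pentagon_tetra_act)
qed

text \<open>The vertex joining \<open>a\<close> and \<open>c\<close> to \<open>u\<close> occurs
  twice on the left, and the three vertices at \<open>e\<close> occur twice on the right, so their
  signs square to 1. The other six vertices are common to both sides.\<close>

lemma pentagon_gauge:
  assumes "p * p = 1" "q * q = 1" and "pentagon tetra x y z w u a b c d"
  shows "pentagon (F p q) x y z w u a b c d"
proof -
  define g where "g = gauge p q x y a * gauge p q a z b * gauge p q b w u * gauge p q z w c
    * gauge p q y c d * gauge p q x d u"
  have "F p q x y c u d a * F p q a z w u c b = g * (tetra x y c u d a * tetra a z w u c b)"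
    by (simp add: F_eq_gauge_tetra g_def assms(1,2) gauge_cancel mult_ac)
  also have "\<dots> = (\<Sum>e\<in>UNIV. g * (tetra y z w d c e * tetra x e w u d b * tetra x y z b e a))"
    using assms(3) by (simp add: pentagon_def sum_distrib_left)
  also have "\<dots> = (\<Sum>e\<in>UNIV. F p q y z w d c e * F p q x e w u d b * F p q x y z b e a)"
    by (simp add: F_eq_gauge_tetra g_def assms(1,2) gauge_cancel mult_ac)
  finally show ?thesis
    by (simp only: pentagon_def)
qed

theorem theorem3p1:
  fixes p\<^sub>1 p\<^sub>2 :: real and x y z w u a b c d :: label
  assumes "p\<^sub>1 \<in> {-1, 1}" and "p\<^sub>2 \<in> {-1, 1}"
    and "N x y a = 1" and "N a z b = 1" and "N b w u = 1"
    and "N z w c = 1" and "N y c d = 1" and "N x d u = 1"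
  shows "F p\<^sub>1 p\<^sub>2 x y c u d a * F p\<^sub>1 p\<^sub>2 a z w u c b =
    (\<Sum>e\<in>{e. N y z e = 1 \<and> N x e b = 1 \<and> N e w d = 1}.
      F p\<^sub>1 p\<^sub>2 y z w d c e * F p\<^sub>1 p\<^sub>2 x e w u d b * F p\<^sub>1 p\<^sub>2 x y z b e a)"
proof -
  have "p\<^sub>1 * p\<^sub>1 = 1" "p\<^sub>2 * p\<^sub>2 = 1"
    using assms(1,2) by auto
  moreover have "pentagon tetra x y z w u a b c d"
    using assms(3-8) by (intro pentagon_tetra) (simp_all add: channels_def)
  ultimately have "F p\<^sub>1 p\<^sub>2 x y c u d a * F p\<^sub>1 p\<^sub>2 a z w u c b =
      (\<Sum>e\<in>UNIV. F p\<^sub>1 p\<^sub>2 y z w d c e * F p\<^sub>1 p\<^sub>2 x e w u d b * F p\<^sub>1 p\<^sub>2 x y z b e a)"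
    using pentagon_gauge by (simp only: pentagon_def)
  also have "\<dots> = (\<Sum>e\<in>{e. N y z e = 1 \<and> N x e b = 1 \<and> N e w d = 1}.
      F p\<^sub>1 p\<^sub>2 y z w d c e * F p\<^sub>1 p\<^sub>2 x e w u d b * F p\<^sub>1 p\<^sub>2 x y z b e a)"
    \<comment> \<open>For any other \<open>e\<close> the guard of \<open>F\<close> fails in some
      factor, which is then 0.\<close>
    by (rule sum.mono_neutral_right) (auto simp: F_def)
  finally show ?thesis .
qed

end
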